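(* Let $X$ be a quasi-projective variety, $\Phi\colon X\dashrightarrow X$ a rational self-map, and $Y\subseteq X$ a subvariety, all defined over $\overline{\mathbb{Q}}$. If $x\in X_\Phi(\overline{\mathbb{Q}})$, then the set $\{n\in\mathbb{N}:\Phi^n(x)\in Y\}$ is the union of finitely many arithmetic progressions together with a set of upper asymptotic density zero.
   Context: $\mathbb{N}=\{0,1,2,\dots\}$. $X_\Phi(\overline{\mathbb{Q}})$ is the set of $x\in X(\overline{\mathbb{Q}})$ such that $\Phi^n(x)$ is not in the indeterminacy locus of $\Phi$ for every $n\in\mathbb{N}$. The upper asymptotic density of $A\subseteq\mathbb{N}$ is $\overline{d}(A)=\limsup_{m\to\infty}|A\cap[1,m]|/m$. *)

theory Defs
  imports
    "HOL-Analysis.Analysis"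
    "HOL-Algebra.Algebraic_Closure_Type"
    "HOL-Library.Poly_Mapping"
begin

section \<open>Projective space over the algebraic numbers\<close>

type_synonym qbar = "rat alg_closure"

text \<open>
  The type \<open>'n proj_space\<close> is the set of \<open>\<rat>\<close>-bar-points of projective \<open>N\<close>-space with
  \<open>CARD('n) = N + 1\<close>: its elements are the lines through the origin.
\<close>

typedef 'n proj_space =
  "{L :: (qbar ^ 'n::finite) set. \<exists>v. v \<noteq> 0 \<and> L = range (\<lambda>c. c *s v)}"
  morphisms line_of proj_of_line
proof -
  have "(1 :: qbar ^ 'n) \<noteq> 0"
    by (simp add: vec_eq_iff)
  then show ?thesis by blast
qed

definition hom_coords :: "'n::finite proj_space \<Rightarrow> (qbar ^ 'n) set" where
  "hom_coords P = line_of P - {0}"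


section \<open>Polynomials in finitely many variables\<close>

type_synonym 'n mpolynomial = "('n \<Rightarrow>\<^sub>0 nat) \<Rightarrow>\<^sub>0 qbar"

definition peval :: "'n::finite mpolynomial \<Rightarrow> qbar ^ 'n \<Rightarrow> qbar" where
  "peval p v = (\<Sum>m\<in>Poly_Mapping.keys p.
     Poly_Mapping.lookup p m * (\<Prod>i\<in>UNIV. v $ i ^ Poly_Mapping.lookup m i))"

definition homogeneous :: "nat \<Rightarrow> 'n::finite mpolynomial \<Rightarrow> bool" where
  "homogeneous d p \<longleftrightarrow>
     (\<forall>m\<in>Poly_Mapping.keys p. (\<Sum>i\<in>UNIV. Poly_Mapping.lookup m i) = d)"

lemma peval_superset:
  assumes "finite K" "Poly_Mapping.keys p \<subseteq> K"
  shows "peval p v = (\<Sum>m\<in>K.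
     Poly_Mapping.lookup p m * (\<Prod>i\<in>UNIV. v $ i ^ Poly_Mapping.lookup m i))"
  unfolding peval_def
  by (rule sum.mono_neutral_left) (use assms in \<open>auto simp: in_keys_iff\<close>)

lemma peval_zero [simp]: "peval 0 v = 0"
  by (simp add: peval_def)

lemma peval_one [simp]: "peval 1 v = 1"
  by (simp add: peval_def flip: single_one)

lemma peval_single:
  "peval (Poly_Mapping.single m c) v = c * (\<Prod>i\<in>UNIV. v $ i ^ Poly_Mapping.lookup m i)"
  by (simp add: peval_def)

lemma peval_add: "peval (p + q) v = peval p v + peval q v"
proof -
  let ?K = "Poly_Mapping.keys p \<union> Poly_Mapping.keys q"
  have "Poly_Mapping.keys (p + q) \<subseteq> ?K"
    by (rule Poly_Mapping.keys_add)
  then show ?thesis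
    by (simp add: peval_superset[of ?K] lookup_add algebra_simps sum.distrib)
qed

lemma peval_sum: "peval (sum f A) v = (\<Sum>a\<in>A. peval (f a) v)"
  by (induction A rule: infinite_finite_induct) (auto simp: peval_add)

lemma mpolynomial_as_sum:
  "(p :: 'n mpolynomial) =
     (\<Sum>m\<in>Poly_Mapping.keys p. Poly_Mapping.single m (Poly_Mapping.lookup p m))"
  by (rule poly_mapping_eqI)
     (auto simp: lookup_sum lookup_single when_def in_keys_iff)

lemma peval_mult: "peval (p * q) v = peval p v * peval q v"
proof -
  let ?s = "\<lambda>p. \<lambda>m. Poly_Mapping.single m (Poly_Mapping.lookup p m)"
  have single: "peval (?s p m * ?s q k) v = peval (?s p m) v * peval (?s q k) v" for m k
    by (simp add: mult_single peval_single lookup_add power_add prod.distrib algebra_simps)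
  have "p * q = (\<Sum>m\<in>Poly_Mapping.keys p. ?s p m) * (\<Sum>k\<in>Poly_Mapping.keys q. ?s q k)"
    using mpolynomial_as_sum[of p] mpolynomial_as_sum[of q] by simp
  then have "peval (p * q) v =
      peval (\<Sum>m\<in>Poly_Mapping.keys p. ?s p m) v * peval (\<Sum>k\<in>Poly_Mapping.keys q. ?s q k) v"
    by (simp add: sum_product peval_sum single)
  then show ?thesis
    by (simp flip: mpolynomial_as_sum)
qed

lemma homogeneous_one: "homogeneous 0 1"
  by (simp add: homogeneous_def flip: single_one)

lemma homogeneous_mult:
  assumes "homogeneous d p" "homogeneous e q"
  shows "homogeneous (d + e) (p * q)"
  unfolding homogeneous_def
proof
  fix m assume "m \<in> Poly_Mapping.keys (p * q)"
  then obtain a b where "m = a + b" "a \<in> Poly_Mapping.keys p" "b \<in> Poly_Mapping.keys q"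
    using keys_mult by blast
  then show "(\<Sum>i\<in>UNIV. Poly_Mapping.lookup m i) = d + e"
    using assms by (simp add: homogeneous_def lookup_add sum.distrib)
qed

lemma peval_scale:
  assumes "homogeneous d p"
  shows "peval p (c *s v) = c ^ d * peval p v"
proof -
  have "Poly_Mapping.lookup p m * (\<Prod>i\<in>UNIV. (c *s v) $ i ^ Poly_Mapping.lookup m i) =
        c ^ d * (Poly_Mapping.lookup p m * (\<Prod>i\<in>UNIV. v $ i ^ Poly_Mapping.lookup m i))"
    if "m \<in> Poly_Mapping.keys p" for m
  proof -
    have "(\<Sum>i\<in>UNIV. Poly_Mapping.lookup m i) = d"
      using that assms by (simp add: homogeneous_def)
    then show ?thesis
      by (simp add: power_mult_distrib prod.distrib algebra_simps flip: power_sum)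
  qed
  then show ?thesis
    unfolding peval_def sum_distrib_left by (intro sum.cong) auto
qed


section \<open>The Zariski topology\<close>

definition zero_locus :: "'n::finite mpolynomial set \<Rightarrow> 'n proj_space set" where
  "zero_locus S = {P. \<forall>p\<in>S. \<forall>v\<in>hom_coords P. peval p v = 0}"

definition algebraic_set :: "'n::finite proj_space set \<Rightarrow> bool" where
  "algebraic_set C \<longleftrightarrow> (\<exists>S. (\<forall>p\<in>S. \<exists>d. homogeneous d p) \<and> C = zero_locus S)"

definition zariski :: "'n::finite proj_space topology" where
  "zariski = topology (\<lambda>U. algebraic_set (- U))"

lemma hom_coordsE:
  assumes "v \<in> hom_coords P" "w \<in> hom_coords P"
  obtains c where "c \<noteq> 0" "w = c *s v"
proof -
  obtain u where u: "line_of P = range (\<lambda>c. c *s u)"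
    using line_of[of P] by auto
  obtain a b where ab: "v = a *s u" "w = b *s u"
    using assms u by (auto simp: hom_coords_def)
  have "a \<noteq> 0" "b \<noteq> 0"
    using assms ab by (auto simp: hom_coords_def)
  then have "b / a \<noteq> 0" "w = (b / a) *s v"
    by (simp_all add: ab vector_smult_assoc)
  then show ?thesis using that by blast
qed

lemma hom_coords_nonempty: "\<exists>v. v \<in> hom_coords P"
proof -
  obtain u where "u \<noteq> 0" "line_of P = range (\<lambda>c. c *s u)"
    using line_of[of P] by auto
  then have "u \<in> hom_coords P"
    by (auto simp: hom_coords_def intro: range_eqI[of _ _ 1])
  then show ?thesis by blast
qed

lemma peval_zero_hom_coords:
  assumes "homogeneous d p" "v \<in> hom_coords P" "w \<in> hom_coords P" "peval p v = 0"
  shows "peval p w = 0"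
proof -
  obtain c where "w = c *s v"
    using hom_coordsE[OF assms(2,3)] by blast
  then show ?thesis
    using assms by (simp add: peval_scale)
qed

lemma algebraic_set_Un:
  assumes "algebraic_set C" "algebraic_set D"
  shows "algebraic_set (C \<union> D)"
proof -
  obtain S T where S: "\<forall>p\<in>S. \<exists>d. homogeneous d p" "C = zero_locus S"
    and T: "\<forall>p\<in>T. \<exists>d. homogeneous d p" "D = zero_locus T"
    using assms by (auto simp: algebraic_set_def)
  let ?ST = "{p * q | p q. p \<in> S \<and> q \<in> T}"
  have hom: "\<forall>r\<in>?ST. \<exists>d. homogeneous d r"
    using S(1) T(1) homogeneous_mult by blast
  have "P \<in> C \<union> D" if "P \<in> zero_locus ?ST" for P
  proof (rule ccontr)
    assume "P \<notin> C \<union> D"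
    then obtain p q v w where pq: "p \<in> S" "q \<in> T" "v \<in> hom_coords P" "w \<in> hom_coords P"
        "peval p v \<noteq> 0" "peval q w \<noteq> 0"
      by (auto simp: S T zero_locus_def)
    then have "peval q v \<noteq> 0"
      using T(1) peval_zero_hom_coords by blast
    then have "peval (p * q) v \<noteq> 0"
      using pq by (simp add: peval_mult)
    moreover have "peval (p * q) v = 0"
      using that pq by (auto simp: zero_locus_def)
    ultimately show False by simp
  qed
  moreover have "C \<union> D \<subseteq> zero_locus ?ST"
    by (auto simp: S T zero_locus_def peval_mult)
  ultimately have "C \<union> D = zero_locus ?ST"
    by blast
  with hom show ?thesis
    unfolding algebraic_set_def by blast
qed

lemma algebraic_set_Inter:
  assumes "\<And>C. C \<in> \<C> \<Longrightarrow> algebraic_set C"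
  shows "algebraic_set (\<Inter>\<C>)"
proof -
  obtain S where S: "\<And>C. C \<in> \<C> \<Longrightarrow> (\<forall>p\<in>S C. \<exists>d. homogeneous d p) \<and> C = zero_locus (S C)"
    using assms unfolding algebraic_set_def by metis
  have "zero_locus (\<Union>C\<in>\<C>. S C) = (\<Inter>C\<in>\<C>. zero_locus (S C))"
    by (auto simp: zero_locus_def)
  also have "\<dots> = \<Inter>\<C>"
    using S by auto
  finally show ?thesis
    unfolding algebraic_set_def using S by (intro exI[of _ "\<Union>C\<in>\<C>. S C"]) auto
qed

lemma istopology_zariski: "istopology (\<lambda>U. algebraic_set (- U))"
  unfolding istopology_def
proof (intro conjI allI impI)
  fix U V :: "'a proj_space set"
  assume "algebraic_set (- U)" "algebraic_set (- V)"
  then show "algebraic_set (- (U \<inter> V))"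
    by (simp add: algebraic_set_Un)
next
  fix \<U> :: "'a proj_space set set"
  assume "\<forall>U\<in>\<U>. algebraic_set (- U)"
  then have "algebraic_set (\<Inter>(uminus ` \<U>))"
    by (intro algebraic_set_Inter) auto
  then show "algebraic_set (- \<Union>\<U>)"
    by (simp add: Compl_UN uminus_Sup)
qed

lemma openin_zariski: "openin zariski U \<longleftrightarrow> algebraic_set (- U)"
  by (simp add: zariski_def topology_inverse'[OF istopology_zariski])

lemma topspace_zariski [simp]: "topspace zariski = UNIV"
proof -
  have "zero_locus {1} = {}"
    using hom_coords_nonempty by (auto simp: zero_locus_def)
  then have "openin zariski (UNIV :: 'a proj_space set)"
    unfolding openin_zariski algebraic_set_def
    by (intro exI[of _ "{1}"]) (auto intro: homogeneous_one)
  then show ?thesis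
    using openin_subset by blast
qed

lemma closedin_zariski: "closedin zariski C \<longleftrightarrow> algebraic_set C"
  by (simp add: closedin_def openin_zariski Compl_eq_Diff_UNIV [symmetric])


section \<open>Quasi-projective varieties and morphisms\<close>

text \<open>
  Varieties are identified with their sets of \<open>\<rat>\<close>-bar-points; they are reduced but not
  required to be irreducible.
\<close>

definition quasi_projective_variety :: "'n::finite proj_space set \<Rightarrow> bool" where
  "quasi_projective_variety \<X> \<longleftrightarrow>
     (\<exists>U C. openin zariski U \<and> closedin zariski C \<and> \<X> = U \<inter> C)"

abbreviation zariski_on :: "'n::finite proj_space set \<Rightarrow> 'n proj_space topology" where
  "zariski_on \<X> \<equiv> subtopology zariski \<X>"

definition subvariety :: "'n::finite proj_space set \<Rightarrow> 'n proj_space set \<Rightarrow> bool" where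
  "subvariety \<Y> \<X> \<longleftrightarrow> closedin (zariski_on \<X>) \<Y>"

definition regular_function :: "'n::finite proj_space set \<Rightarrow> ('n proj_space \<Rightarrow> qbar) \<Rightarrow> bool" where
  "regular_function V f \<longleftrightarrow>
     (\<forall>P\<in>V. \<exists>W p q d. openin (zariski_on V) W \<and> P \<in> W \<and> homogeneous d p \<and> homogeneous d q \<and>
        (\<forall>Q\<in>W. \<forall>v\<in>hom_coords Q. peval q v \<noteq> 0 \<and> f Q = peval p v / peval q v))"

definition morphism ::
  "'n::finite proj_space set \<Rightarrow> 'm::finite proj_space set \<Rightarrow> ('n proj_space \<Rightarrow> 'm proj_space) \<Rightarrow> bool"
where
  "morphism \<X> \<Y> f \<longleftrightarrow>
     continuous_map (zariski_on \<X>) (zariski_on \<Y>) f \<and>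
     (\<forall>V g. openin (zariski_on \<Y>) V \<longrightarrow> regular_function V g \<longrightarrow>
        regular_function {x \<in> \<X>. f x \<in> V} (g \<circ> f))"


section \<open>Rational maps\<close>

definition dense_open :: "'n::finite proj_space set \<Rightarrow> 'n proj_space set \<Rightarrow> bool" where
  "dense_open \<X> U \<longleftrightarrow> openin (zariski_on \<X>) U \<and> zariski_on \<X> closure_of U = \<X>"

type_synonym ('n, 'm) partial_map = "'n proj_space set \<times> ('n proj_space \<Rightarrow> 'm proj_space)"

definition partial_morphisms ::
  "'n::finite proj_space set \<Rightarrow> 'm::finite proj_space set \<Rightarrow> ('n, 'm) partial_map set"
where
  "partial_morphisms \<X> \<Y> = {(U, f). dense_open \<X> U \<and> morphism U \<Y> f}"

definition rational_equiv ::
  "'n::finite proj_space set \<Rightarrow> 'm::finite proj_space set \<Rightarrow>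
     (('n, 'm) partial_map \<times> ('n, 'm) partial_map) set"
where
  "rational_equiv \<X> \<Y> =
     {((U, f), (V, g)). (U, f) \<in> partial_morphisms \<X> \<Y> \<and> (V, g) \<in> partial_morphisms \<X> \<Y> \<and>
        (\<exists>W. dense_open \<X> W \<and> W \<subseteq> U \<inter> V \<and> (\<forall>x\<in>W. f x = g x))}"

definition rational_maps ::
  "'n::finite proj_space set \<Rightarrow> 'm::finite proj_space set \<Rightarrow> ('n, 'm) partial_map set set"
where
  "rational_maps \<X> \<Y> = partial_morphisms \<X> \<Y> // rational_equiv \<X> \<Y>"

lemma dense_open_Int:
  assumes "dense_open \<X> U" "dense_open \<X> V"
  shows "dense_open \<X> (U \<inter> V)"
proof -
  have "zariski_on \<X> closure_of (U \<inter> V) = zariski_on \<X> closure_of U"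
    using assms closure_of_openin_Int_superset[of "zariski_on \<X>" U V]
    by (auto simp: dense_open_def dest: openin_subset)
  then show ?thesis
    using assms by (simp add: dense_open_def openin_Int)
qed

lemma equiv_rational_equiv: "equiv (partial_morphisms \<X> \<Y>) (rational_equiv \<X> \<Y>)"
proof (rule equivI)
  show "rational_equiv \<X> \<Y> \<subseteq> partial_morphisms \<X> \<Y> \<times> partial_morphisms \<X> \<Y>"
    by (auto simp: rational_equiv_def)
  show "refl_on (partial_morphisms \<X> \<Y>) (rational_equiv \<X> \<Y>)"
    by (auto simp: refl_on_def rational_equiv_def partial_morphisms_def)
  show "sym (rational_equiv \<X> \<Y>)"
    unfolding sym_def rational_equiv_def by (fastforce simp: Int_commute)
  show "trans (rational_equiv \<X> \<Y>)"
  proof (rule transI)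
    fix F G H
    assume "(F, G) \<in> rational_equiv \<X> \<Y>" "(G, H) \<in> rational_equiv \<X> \<Y>"
    then obtain U f V g S h W W' where
      FGH: "F = (U, f)" "G = (V, g)" "H = (S, h)"
        "F \<in> partial_morphisms \<X> \<Y>" "H \<in> partial_morphisms \<X> \<Y>"
      and W: "dense_open \<X> W" "W \<subseteq> U \<inter> V" "\<forall>x\<in>W. f x = g x"
      and W': "dense_open \<X> W'" "W' \<subseteq> V \<inter> S" "\<forall>x\<in>W'. g x = h x"
      unfolding rational_equiv_def by blast
    have "dense_open \<X> (W \<inter> W')" "W \<inter> W' \<subseteq> U \<inter> S" "\<forall>x\<in>W \<inter> W'. f x = h x"
      using W W' dense_open_Int by auto
    with FGH show "(F, H) \<in> rational_equiv \<X> \<Y>"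
      unfolding rational_equiv_def by blast
  qed
qed

definition rat_domain :: "('n, 'm) partial_map set \<Rightarrow> 'n::finite proj_space set" where
  "rat_domain \<Phi> = (\<Union>(U, f)\<in>\<Phi>. U)"

definition indeterminacy_locus ::
  "'n::finite proj_space set \<Rightarrow> ('n, 'm) partial_map set \<Rightarrow> 'n proj_space set"
where
  "indeterminacy_locus \<X> \<Phi> = \<X> - rat_domain \<Phi>"

text \<open>
  On \<open>rat_domain \<Phi>\<close> all representatives defined at \<open>x\<close> take the same value there, because
  quasi-projective varieties are separated. Outside of it \<open>rat_apply \<Phi> x\<close> is unspecified.
\<close>

definition rat_apply :: "('n, 'm) partial_map set \<Rightarrow> 'n::finite proj_space \<Rightarrow> 'm::finite proj_space"
where
  "rat_apply \<Phi> x = (THE y. \<exists>(U, f)\<in>\<Phi>. x \<in> U \<and> y = f x)"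

definition rat_iterate ::
  "('n, 'n) partial_map set \<Rightarrow> nat \<Rightarrow> 'n::finite proj_space \<Rightarrow> 'n proj_space"
where
  "rat_iterate \<Phi> n x = (rat_apply \<Phi> ^^ n) x"

definition well_defined_orbit_points ::
  "'n::finite proj_space set \<Rightarrow> ('n, 'n) partial_map set \<Rightarrow> 'n proj_space set"
where
  "well_defined_orbit_points \<X> \<Phi> =
     {x \<in> \<X>. \<forall>n. rat_iterate \<Phi> n x \<notin> indeterminacy_locus \<X> \<Phi>}"


section \<open>Arithmetic progressions and density\<close>

definition arithmetic_progression :: "nat set \<Rightarrow> bool" where
  "arithmetic_progression A \<longleftrightarrow> (\<exists>a d. d > 0 \<and> A = range (\<lambda>k. a + k * d))"

definition upper_density :: "nat set \<Rightarrow> ereal" where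
  "upper_density A = limsup (\<lambda>m. ereal (real (card (A \<inter> {1..m})) / real m))"

end

theory Submission
  imports Defs
begin

text \<open>
  Only two facts about the orbit \<open>y\<^sub>n = \<Phi>\<^sup>n(x)\<close> matter: the Zariski topology is Noetherian, and
  \<open>\<Phi>\<close> is continuous on its domain, so that \<open>{n. y\<^sub>n\<^sub>+\<^sub>k \<in> C}\<close> is again cut out by a closed set.
  By Noetherian induction on a closed set \<open>C\<close>, put \<open>N = {n. y\<^sub>n \<in> C}\<close>. If \<open>N + k \<subseteq> N\<close> for some
  \<open>k \<ge> 1\<close>, then \<open>N\<close> is a finite union of progressions. Otherwise the induction hypothesis applies to
  every \<open>N \<inter> (N - k)\<close> with \<open>k \<ge> 1\<close>. If all of these have density zero, so has \<open>N\<close>, since a set with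
  all gaps larger than \<open>k\<close> has density at most \<open>1 / k\<close>. If not, \<open>N\<close> contains a progression of some
  difference \<open>d\<close>, and then \<open>N\<close> is, up to a finite set, the union of the \<open>N \<inter> (N - e)\<close> with
  \<open>1 \<le> e \<le> d\<close>.
\<close>

section \<open>Sets of natural numbers\<close>

text \<open>The ratios are nonnegative, so convergence to 0 says the same as
  \<open>upper_density A = 0\<close>; as limits they can be added and squeezed.\<close>

definition density_zero :: "nat set \<Rightarrow> bool" where
  "density_zero A \<longleftrightarrow> (\<lambda>m. real (card (A \<inter> {1..m})) / real m) \<longlonglongrightarrow> 0"

definition progressions_up_to_density_zero :: "nat set \<Rightarrow> bool" where
  "progressions_up_to_density_zero N \<longleftrightarrow>
     (\<exists>\<A> Z. finite \<A> \<and> (\<forall>A\<in>\<A>. arithmetic_progression A) \<and> density_zero Z \<and> N = \<Union>\<A> \<union> Z)"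

lemma density_zero_imp_upper_density:
  assumes "density_zero A"
  shows "upper_density A = 0"
proof -
  have "(\<lambda>m. ereal (real (card (A \<inter> {1..m})) / real m)) \<longlonglongrightarrow> ereal 0"
    using assms by (simp add: density_zero_def)
  then show ?thesis
    unfolding upper_density_def zero_ereal_def by (intro lim_imp_Limsup) auto
qed

lemma density_zero_subset:
  assumes "density_zero B" "A \<subseteq> B"
  shows "density_zero A"
  unfolding density_zero_def
proof (rule tendsto_sandwich[OF _ _ tendsto_const assms(1)[unfolded density_zero_def]])
  show "\<forall>\<^sub>F m in sequentially.
      real (card (A \<inter> {1..m})) / real m \<le> real (card (B \<inter> {1..m})) / real m"
    using assms(2) by (intro always_eventually allI divide_right_mono) (auto intro!: card_mono)
qed auto

lemma density_zero_Un:
  assumes "density_zero A" "density_zero B"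
  shows "density_zero (A \<union> B)"
  unfolding density_zero_def
proof (rule tendsto_sandwich[OF _ _ tendsto_const])
  show "(\<lambda>m. real (card (A \<inter> {1..m})) / real m + real (card (B \<inter> {1..m})) / real m)
      \<longlonglongrightarrow> 0"
    using tendsto_add[OF assms[unfolded density_zero_def]] by simp
  have "real (card ((A \<union> B) \<inter> {1..m})) \<le> real (card (A \<inter> {1..m})) + real (card (B \<inter> {1..m}))"
    for m
    by (metis Int_Un_distrib2 card_Un_le of_nat_add of_nat_le_iff)
  then show "\<forall>\<^sub>F m in sequentially. real (card ((A \<union> B) \<inter> {1..m})) / real m
      \<le> real (card (A \<inter> {1..m})) / real m + real (card (B \<inter> {1..m})) / real m"
    by (intro always_eventually allI) (simp add: divide_right_mono flip: add_divide_distrib)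
qed auto

lemma density_zero_finite:
  assumes "finite A"
  shows "density_zero A"
  unfolding density_zero_def
proof (rule tendsto_sandwich[OF _ _ tendsto_const lim_const_over_n])
  show "\<forall>\<^sub>F m in sequentially. real (card (A \<inter> {1..m})) / real m \<le> real (card A) / of_nat m"
    using assms by (intro always_eventually allI divide_right_mono) (auto intro!: card_mono)
qed auto

lemma density_zero_UN:
  assumes "finite I" "\<And>i. i \<in> I \<Longrightarrow> density_zero (A i)"
  shows "density_zero (\<Union>i\<in>I. A i)"
  using assms by (induction I) (auto intro: density_zero_Un density_zero_finite)

text \<open>Two elements of \<open>A\<close> in one block of \<open>k\<close> consecutive integers
  would differ by less than \<open>k\<close>, so each block holds at most one. The blocks with
  indices \<open>0\<close> to \<open>m div k\<close> cover \<open>{1..m}\<close>.\<close>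

lemma card_le_of_large_gaps:
  assumes "k > 0" and gaps: "\<And>n i. n \<in> A \<Longrightarrow> i \<in> {1..k} \<Longrightarrow> n + i \<notin> A"
  shows "real (card (A \<inter> {1..m})) \<le> real m / real k + 1"
proof -
  have lt: False if "n \<in> A" "n' \<in> A" "n < n'" "n div k = n' div k" for n n'
  proof -
    have "n' < n + k"
      using that(4) dividend_less_div_times[OF \<open>k > 0\<close>, of n'] div_times_less_eq_dividend[of n k]
      by simp
    then show False
      using gaps[OF that(1), of "n' - n"] that(2,3) by (simp add: Suc_le_eq le_diff_conv)
  qed
  have "inj_on (\<lambda>n. n div k) (A \<inter> {1..m})"
    by (rule inj_onI) (metis IntD1 lt nat_neq_iff)
  moreover have "(\<lambda>n. n div k) ` (A \<inter> {1..m}) \<subseteq> {0..m div k}"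
    by (auto intro: div_le_mono)
  ultimately have "card (A \<inter> {1..m}) \<le> card {0..m div k}"
    by (intro card_inj_on_le) auto
  then have "real (card (A \<inter> {1..m})) \<le> real (m div k) + 1"
    by simp
  also have "real (m div k) \<le> real m / real k"
    by (rule of_nat_div_le_of_nat)
  finally show ?thesis by simp
qed

text \<open>A recurrence principle: the elements of \<open>N\<close> whose successor in \<open>N\<close> is more than \<open>k\<close> away
  have density at most \<open>1 / k\<close>.\<close>

lemma density_zero_if_shifts_density_zero:
  assumes "\<And>i. i \<ge> 1 \<Longrightarrow> density_zero (N \<inter> {n. n + i \<in> N})"
  shows "density_zero N"
  unfolding density_zero_def
proof (rule LIMSEQ_I)
  fix e :: real assume "e > 0"
  \<comment> \<open>The tolerance is shared by three terms: the density of \<open>M\<close>, then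
    \<open>1 / k\<close>, then \<open>1 / m\<close>, which is at most \<open>1 / k\<close> once
    \<open>m > k\<close>.\<close>
  obtain k where k: "k > 0" "1 / real k < e / 3"
    using \<open>e > 0\<close> nat_approx_posE[of "e / 3"] by (metis divide_pos_pos zero_less_Suc zero_less_numeral)
  define M where "M = (\<Union>i\<in>{1..k}. N \<inter> {n. n + i \<in> N})"
  have "density_zero M"
    unfolding M_def using assms by (intro density_zero_UN) auto
  then obtain m0 where m0: "\<And>m. m \<ge> m0 \<Longrightarrow> real (card (M \<inter> {1..m})) / real m < e / 3"
    using LIMSEQ_D[of _ 0 "e / 3"] \<open>e > 0\<close> unfolding density_zero_def by fastforce
  have "real (card (N \<inter> {1..m})) / real m < e" if m: "m \<ge> Suc (max m0 k)" for m
  proof -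
    have "N \<inter> {1..m} \<subseteq> (M \<inter> {1..m}) \<union> ((N - M) \<inter> {1..m})"
      by auto
    then have "card (N \<inter> {1..m}) \<le> card (M \<inter> {1..m}) + card ((N - M) \<inter> {1..m})"
      by (metis (no_types, lifting) card_Un_le card_mono finite_Int finite_Un finite_atLeastAtMost
        order_trans)
    moreover have "real (card ((N - M) \<inter> {1..m})) \<le> real m / real k + 1"
      using k(1) by (intro card_le_of_large_gaps) (auto simp: M_def)
    ultimately have "real (card (N \<inter> {1..m})) \<le> real (card (M \<inter> {1..m})) + (real m / real k + 1)"
      by linarith
    then have "real (card (N \<inter> {1..m})) / real m
        \<le> (real (card (M \<inter> {1..m})) + (real m / real k + 1)) / real m"
      by (rule divide_right_mono) simp
    also have "\<dots> = real (card (M \<inter> {1..m})) / real m + 1 / real k + 1 / real m"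
      using m by (simp add: add_divide_distrib)
    also have "1 / real m \<le> 1 / real k"
      using m k(1) by (intro divide_left_mono) auto
    finally show ?thesis
      using m0[of m] m k(2) by linarith
  qed
  then show "\<exists>no. \<forall>m\<ge>no. norm (real (card (N \<inter> {1..m})) / real m - 0) < e"
    by (intro exI[of _ "Suc (max m0 k)"]) auto
qed

section \<open>Unions of progressions up to density zero, and shift-invariant sets\<close>

lemma progressions_up_to_density_zero_Un:
  assumes "progressions_up_to_density_zero A" "progressions_up_to_density_zero B"
  shows "progressions_up_to_density_zero (A \<union> B)"
proof -
  obtain \<A> Z \<B> W where
    "finite \<A>" "\<forall>A\<in>\<A>. arithmetic_progression A" "density_zero Z" "A = \<Union>\<A> \<union> Z"
    "finite \<B>" "\<forall>A\<in>\<B>. arithmetic_progression A" "density_zero W" "B = \<Union>\<B> \<union> W"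
    using assms unfolding progressions_up_to_density_zero_def by metis
  then show ?thesis
    unfolding progressions_up_to_density_zero_def
    by (intro exI[of _ "\<A> \<union> \<B>"] exI[of _ "Z \<union> W"]) (auto intro: density_zero_Un)
qed

lemma density_zero_imp_progressions:
  "density_zero A \<Longrightarrow> progressions_up_to_density_zero A"
  unfolding progressions_up_to_density_zero_def by (intro exI[of _ "{}"] exI[of _ A]) auto

lemma progressions_up_to_density_zero_UN:
  assumes "finite I" "\<And>i. i \<in> I \<Longrightarrow> progressions_up_to_density_zero (A i)"
  shows "progressions_up_to_density_zero (\<Union>i\<in>I. A i)"
  using assms
  by (induction I)
     (auto intro: progressions_up_to_density_zero_Un density_zero_imp_progressions density_zero_finite)

text \<open>In each residue class modulo \<open>d\<close> that \<open>N\<close> meets,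
  \<open>N\<close> contains everything from its least element there onwards.\<close>

lemma progressions_if_shift_invariant:
  assumes "d > 0" and shift: "\<And>n. n \<in> N \<Longrightarrow> n + d \<in> N"
  shows "progressions_up_to_density_zero N"
proof -
  define N' where "N' r = {n \<in> N. n mod d = r}" for r
  have iter: "n + k * d \<in> N" if "n \<in> N" for n k
  proof (induction k)
    case (Suc k)
    then show ?case
      using shift[of "n + k * d"] by (simp add: algebra_simps)
  qed (use that in simp)
  have AP: "arithmetic_progression (N' r)" if "N' r \<noteq> {}" for r
  proof -
    define a where "a = (LEAST n. n \<in> N' r)"
    have a: "a \<in> N' r"
      unfolding a_def using that by (metis LeastI ex_in_conv)
    have "N' r = range (\<lambda>k. a + k * d)"
    proof (intro equalityI subsetI)
      fix n assume n: "n \<in> N' r"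
      then have "a \<le> n"
        unfolding a_def by (rule Least_le)
      moreover have "n mod d = a mod d"
        using n a by (simp add: N'_def)
      ultimately obtain k where "n = a + d * k"
        by (metis mod_eq_dvd_iff_nat dvdE le_add_diff_inverse)
      then show "n \<in> range (\<lambda>k. a + k * d)"
        by (auto simp: mult.commute)
    next
      fix n assume "n \<in> range (\<lambda>k. a + k * d)"
      then show "n \<in> N' r"
        using a iter by (auto simp: N'_def)
    qed
    then show ?thesis
      unfolding arithmetic_progression_def using \<open>d > 0\<close> by blast
  qed
  have "progressions_up_to_density_zero (N' r)" for r
  proof (cases "N' r = {}")
    case True
    then show ?thesis
      by (simp add: density_zero_imp_progressions density_zero_finite)
  next
    case False
    then show ?thesis
      unfolding progressions_up_to_density_zero_def using AP
      by (intro exI[of _ "{N' r}"] exI[of _ "{}"]) (auto intro: density_zero_finite)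
  qed
  then have "progressions_up_to_density_zero (\<Union>r\<in>{..<d}. N' r)"
    by (intro progressions_up_to_density_zero_UN) auto
  moreover have "N = (\<Union>r\<in>{..<d}. N' r)"
    using \<open>d > 0\<close> by (auto simp: N'_def)
  ultimately show ?thesis by simp
qed


section \<open>Return times in Noetherian spaces\<close>

text \<open>The hypothesis \<open>preimage\<close> constrains \<open>B\<close> only along the orbit,
  which suits a map defined on part of the space only.\<close>

lemma return_times_noetherian:
  fixes y :: "nat \<Rightarrow> 'a" and closed_set :: "'a set \<Rightarrow> bool"
  assumes dcc: "wf {(A, B). closed_set A \<and> closed_set B \<and> A \<subset> B}"
    and closed_Int: "\<And>A B. closed_set A \<Longrightarrow> closed_set B \<Longrightarrow> closed_set (A \<inter> B)"
    and preimage: "\<And>A. closed_set A \<Longrightarrow> \<exists>B. closed_set B \<and> (\<forall>n. y n \<in> B \<longleftrightarrow> y (Suc n) \<in> A)"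
    and "closed_set C"
  shows "progressions_up_to_density_zero {n. y n \<in> C}"
  using \<open>closed_set C\<close>
proof (induction C rule: wf_induct_rule[OF dcc])
  case (1 C)
  define N where "N = {n. y n \<in> C}"
  have shifted: "\<exists>B. closed_set B \<and> (\<forall>n. y n \<in> B \<longleftrightarrow> y (n + k) \<in> C)" for k
  proof (induction k)
    case 0
    then show ?case using 1(2) by auto
  next
    case (Suc k)
    then obtain B where "closed_set B" "\<forall>n. y n \<in> B \<longleftrightarrow> y (n + k) \<in> C"
      by blast
    then show ?case
      using preimage[of B] by fastforce
  qed
  show ?case
  proof (cases "\<exists>d>0. \<forall>n\<in>N. n + d \<in> N")
    case True
    then show ?thesis
      using progressions_if_shift_invariant unfolding N_def by blast
  next
    case False
    have sub: "progressions_up_to_density_zero (N \<inter> {n. n + k \<in> N})" if k: "k > 0" for k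
    proof -
      obtain B where B: "closed_set B" "\<forall>n. y n \<in> B \<longleftrightarrow> y (n + k) \<in> C"
        using shifted by blast
      \<comment> \<open>This \<open>n\<close> shows that the inclusion is proper: \<open>y n\<close>
        lies in \<open>C\<close> but not in \<open>B\<close>.\<close>
      obtain n where "n \<in> N" "n + k \<notin> N"
        using False k by blast
      then have "C \<inter> B \<subset> C"
        using B(2) by (auto simp: N_def)
      moreover have "closed_set (C \<inter> B)"
        using 1(2) B(1) by (rule closed_Int)
      ultimately have "progressions_up_to_density_zero {n. y n \<in> C \<inter> B}"
        using 1 by blast
      moreover have "{n. y n \<in> C \<inter> B} = N \<inter> {n. n + k \<in> N}"
        using B(2) by (auto simp: N_def)
      ultimately show ?thesis by simp
    qed
    have "progressions_up_to_density_zero N"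
    proof (cases "\<forall>k\<ge>1. density_zero (N \<inter> {n. n + k \<in> N})")
      case True
      then show ?thesis
        using density_zero_if_shifts_density_zero density_zero_imp_progressions by blast
    next
      case False
      then obtain k where "k > 0" "\<not> density_zero (N \<inter> {n. n + k \<in> N})"
        by (auto simp: Suc_le_eq)
      moreover obtain \<A> Z where "\<forall>A\<in>\<A>. arithmetic_progression A" "density_zero Z"
        "N \<inter> {n. n + k \<in> N} = \<Union>\<A> \<union> Z"
        using sub[OF \<open>k > 0\<close>] unfolding progressions_up_to_density_zero_def
        by (elim exE conjE) (rule that)
      \<comment> \<open>With \<open>\<A>\<close> empty, the intersection would equal
        \<open>Z\<close> and have density zero.\<close>
      ultimately obtain A where "arithmetic_progression A" "A \<subseteq> N"
        by (cases "\<A> = {}") auto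
      then obtain a d where ad: "d > 0" "\<And>k. a + k * d \<in> N"
        unfolding arithmetic_progression_def by blast
      \<comment> \<open>Every \<open>n \<ge> a\<close> lies at distance at most \<open>d\<close> below the progression.\<close>
      have "\<exists>e\<in>{1..d}. n + e \<in> N" if "n \<ge> a" for n
      proof -
        define q r where "q = (n - a) div d" and "r = (n - a) mod d"
        have "n = a + (q * d + r)" "r < d"
          using that ad(1) by (simp_all add: q_def r_def)
        \<comment> \<open>Aiming at term \<open>Suc q\<close> rather than \<open>q\<close> keeps the
          distance positive even for \<open>r = 0\<close>, as \<open>sub\<close> requires.\<close>
        then have "n + (d - r) = a + Suc q * d" "d - r \<in> {1..d}"
          by auto
        then show ?thesis
          using ad(2) by metis
      qed
      then have "N = (N \<inter> {..<a}) \<union> (\<Union>e\<in>{1..d}. N \<inter> {n. n + e \<in> N})"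
        using not_less by blast
      moreover have "progressions_up_to_density_zero (\<Union>e\<in>{1..d}. N \<inter> {n. n + e \<in> N})"
        by (intro progressions_up_to_density_zero_UN sub) auto
      ultimately show ?thesis
        using progressions_up_to_density_zero_Un[OF density_zero_imp_progressions[OF
          density_zero_finite[of "N \<inter> {..<a}"]]] by (metis finite_Int finite_lessThan)
    qed
    then show ?thesis
      by (simp add: N_def)
  qed
qed


section \<open>The Zariski topology is Noetherian\<close>

lemma ex_coordinatewise_incseq_subseq:
  fixes m :: "nat \<Rightarrow> 'n \<Rightarrow> nat"
  assumes "finite I"
  shows "\<exists>r. strict_mono r \<and> (\<forall>i\<in>I. incseq (\<lambda>k. m (r k) i))"
  using assms
proof (induction I)
  case empty
  then show ?case by (auto intro: strict_mono_id)
next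
  case (insert i I)
  then obtain r where r: "strict_mono r" "\<forall>i\<in>I. incseq (\<lambda>k. m (r k) i)"
    by blast
  let ?a = "\<lambda>k. m (r k) i"
  have "\<exists>s. strict_mono s \<and> incseq (\<lambda>k. ?a (s k))"
  proof -
    obtain s where s: "strict_mono s" "monoseq (\<lambda>k. ?a (s k))"
      using seq_monosub[of ?a] by blast
    show ?thesis
    proof (cases "incseq (\<lambda>k. ?a (s k))")
      case True
      with s show ?thesis by blast
    next
      case False
      then have dec: "decseq (\<lambda>k. ?a (s k))"
        using s(2) by (simp add: monoseq_iff)
      \<comment> \<open>A nonincreasing sequence of naturals is constant once it attains its minimum
        \<open>v\<close>, and this tail is nondecreasing.\<close>
      define v where "v = (LEAST v. v \<in> range (\<lambda>k. ?a (s k)))"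
      have "v \<in> range (\<lambda>k. ?a (s k))"
        unfolding v_def by (rule LeastI) (rule rangeI)
      then obtain K where K: "v = ?a (s K)"
        by auto
      have "?a (s (k + K)) = v" for k
      proof (rule antisym)
        show "?a (s (k + K)) \<le> v"
          unfolding K using dec by (rule decseqD) simp
        show "v \<le> ?a (s (k + K))"
          unfolding v_def by (rule Least_le) (rule rangeI)
      qed
      then have "incseq (\<lambda>k. ?a (s (k + K)))"
        by (simp add: incseq_def)
      moreover have "strict_mono (\<lambda>k. s (k + K))"
        using s(1) by (simp add: strict_mono_def)
      ultimately show ?thesis by blast
    qed
  qed
  then obtain s where s: "strict_mono s" "incseq (\<lambda>k. ?a (s k))"
    by blast
  have "incseq (\<lambda>k. m (r (s k)) j)" if "j \<in> I" for j
    using r(2) that s(1) by (simp add: incseq_def strict_mono_less_eq)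
  then show ?case
    using r(1) s by (intro exI[of _ "\<lambda>k. r (s k)"]) (auto simp: strict_mono_def)
qed

text \<open>When all exponents are nondecreasing along a subsequence, its first monomial divides its
  second, and \<open>t\<close> is the quotient. Subtraction of exponents is truncated, so it inverts
  addition only thanks to this monotonicity.\<close>

lemma Dickson_monomials:
  fixes m :: "nat \<Rightarrow> ('n::finite \<Rightarrow>\<^sub>0 nat)"
  shows "\<exists>i j t. i < j \<and> m j = t + m i"
proof -
  obtain r where r: "strict_mono r" "\<And>i. incseq (\<lambda>k. Poly_Mapping.lookup (m (r k)) i)"
    using ex_coordinatewise_incseq_subseq[of UNIV "\<lambda>k. Poly_Mapping.lookup (m k)"] by auto
  have "m (r 1) = (m (r 1) - m (r 0)) + m (r 0)"
    by (rule poly_mapping_eqI) (use r(2) in \<open>simp add: lookup_add lookup_minus incseq_def\<close>)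
  moreover have "r 0 < r 1"
    using r(1) by (simp add: strict_mono_def)
  ultimately show ?thesis by blast
qed

text \<open>Sending the variables to distinct primes embeds the monomials into the natural numbers and
  thereby yields a monomial well-order.\<close>

lemma monomial_code:
  obtains wt :: "('n::finite \<Rightarrow>\<^sub>0 nat) \<Rightarrow> nat"
  where "inj wt" "\<And>a b. wt (a + b) = wt a * wt b"
proof -
  obtain e :: "'n \<Rightarrow> nat" where e: "inj e"
    using finite_imp_inj_to_nat_seg[of "UNIV :: 'n set"] by auto
  define pr where "pr i = enumerate {p::nat. normalization_semidom_class.prime p} (e i)" for i
  have prime: "normalization_semidom_class.prime (pr i)" for i
    using enumerate_in_set[OF primes_infinite] by (auto simp: pr_def)
  have inj: "inj pr"
  proof (rule injI)
    fix i j assume "pr i = pr j"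
    then have "e i = e j"
      unfolding pr_def using strict_mono_enumerate[OF primes_infinite]
      by (simp add: strict_mono_eq)
    then show "i = j"
      using e by (simp add: inj_eq)
  qed
  define wt where "wt a = (\<Prod>i\<in>UNIV. pr i ^ Poly_Mapping.lookup a i)" for a
  \<comment> \<open>Unique factorisation recovers every exponent from the code, whence
    injectivity.\<close>
  have mult: "multiplicity (pr j) (wt a) = Poly_Mapping.lookup a j" for a j
  proof -
    have "wt a = (\<Prod>p\<in>range pr. p ^ Poly_Mapping.lookup a (inv_into UNIV pr p))"
      unfolding wt_def by (subst prod.reindex[OF inj]) (simp add: inv_f_f[OF inj])
    then show ?thesis
      using multiplicity_prod_prime_powers[of "range pr" "pr j" "\<lambda>p. Poly_Mapping.lookup a (inv_into UNIV pr p)"]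
        prime by (auto simp: inv_f_f[OF inj])
  qed
  show ?thesis
  proof
    show "inj wt"
      by (rule injI, rule poly_mapping_eqI) (metis mult)
    show "wt (a + b) = wt a * wt b" for a b
      by (simp add: wt_def lookup_add power_add prod.distrib)
  qed
qed

section \<open>Ascending chains of polynomial ideals and descending chains of closed sets\<close>

lemma lookup_single_mult:
  fixes g :: "('n \<Rightarrow>\<^sub>0 nat) \<Rightarrow>\<^sub>0 'a::field"
  shows "Poly_Mapping.lookup (Poly_Mapping.single t c * g) (t + l) = c * Poly_Mapping.lookup g l"
  by (simp add: lookup_mult lookup_single when_mult)

text \<open>Hilbert's basis theorem in chain form. Choose \<open>r n\<close> in
  \<open>I (Suc n) - I n\<close> with least leading monomial. By Dickson's lemma one leading
  monomial divides a later one; cancelling the later leading term leaves an element outside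
  \<open>I j\<close> that contradicts the minimality of \<open>r j\<close>.\<close>

lemma ideal_chain_not_strict:
  fixes I :: "nat \<Rightarrow> (('n::finite \<Rightarrow>\<^sub>0 nat) \<Rightarrow>\<^sub>0 'a::field) set"
  assumes zero: "\<And>n. 0 \<in> I n"
    and add: "\<And>n p q. p \<in> I n \<Longrightarrow> q \<in> I n \<Longrightarrow> p + q \<in> I n"
    and mult: "\<And>n p q. p \<in> I n \<Longrightarrow> q * p \<in> I n"
    and strict: "\<And>n. I n \<subset> I (Suc n)"
  shows False
proof -
  obtain wt :: "('n \<Rightarrow>\<^sub>0 nat) \<Rightarrow> nat" where
    wt: "inj wt" "\<And>a b. wt (a + b) = wt a * wt b"
    by (rule monomial_code) blast
  \<comment> \<open>\<open>D p\<close> is the code of the leading monomial. The minimisation runs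
    over \<open>p\<close> outside \<open>I n\<close>, hence nonzero.\<close>
  define D where "D p = Max (wt ` Poly_Mapping.keys p)" for p :: "('n \<Rightarrow>\<^sub>0 nat) \<Rightarrow>\<^sub>0 'a"
  have "\<exists>p. p \<in> I (Suc n) - I n \<and> (\<forall>q\<in>I (Suc n) - I n. D p \<le> D q)" for n
    using strict[of n] ex_has_least_nat[of "\<lambda>p. p \<in> I (Suc n) - I n" _ D] by blast
  then obtain r where r: "\<And>n. r n \<in> I (Suc n) - I n"
    "\<And>n q. q \<in> I (Suc n) - I n \<Longrightarrow> D (r n) \<le> D q"
    by metis
  have "\<exists>m\<in>Poly_Mapping.keys (r n). wt m = D (r n)" for n
  proof -
    have "r n \<noteq> 0"
      using r(1)[of n] zero[of n] by auto
    then have "D (r n) \<in> wt ` Poly_Mapping.keys (r n)"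
      unfolding D_def by (intro Max_in) auto
    then show ?thesis by auto
  qed
  then obtain m where m: "\<And>n. m n \<in> Poly_Mapping.keys (r n)" "\<And>n. wt (m n) = D (r n)"
    by metis
  have D_ge: "wt k \<le> D p" if "k \<in> Poly_Mapping.keys p" for k p
    unfolding D_def using that by auto
  obtain i j t where ij: "i < j" "m j = t + m i"
    using Dickson_monomials by blast
  \<comment> \<open>With this quotient the terms of \<open>r j\<close> and \<open>s\<close> at
    \<open>m j\<close> cancel in \<open>h\<close>.\<close>
  define c where "c = Poly_Mapping.lookup (r j) (m j) / Poly_Mapping.lookup (r i) (m i)"
  define s where "s = Poly_Mapping.single t (- c) * r i"
  define h where "h = r j + s"
  have mono: "I a \<subseteq> I b" if "a \<le> b" for a b
    using strict by (intro lift_Suc_mono_le[of I, OF _ that]) (rule psubset_imp_subset)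
  have s: "s \<in> I j"
    unfolding s_def using r(1)[of i] mono[of "Suc i" j] ij(1) by (intro mult) auto
  then have "h \<in> I (Suc j)"
    unfolding h_def using r(1)[of j] mono[of j "Suc j"] by (intro add) auto
  moreover have "h \<notin> I j"
  proof
    assume "h \<in> I j"
    then have "h + (- 1) * s \<in> I j"
      using s by (intro add mult)
    then show False
      using r(1)[of j] by (simp add: h_def)
  qed
  ultimately have le: "D (r j) \<le> D h" and "h \<noteq> 0"
    using r(2) zero[of j] by auto
  then have "D h \<in> wt ` Poly_Mapping.keys h"
    unfolding D_def by (intro Max_in) auto
  then obtain k where k: "k \<in> Poly_Mapping.keys h" "wt k = D h"
    by auto
  have "wt k \<le> wt (m j)"
  proof (cases "k \<in> Poly_Mapping.keys (r j)")
    case True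
    then show ?thesis
      using D_ge m(2) by metis
  next
    case False
    then have "k \<in> Poly_Mapping.keys s"
      using k(1) Poly_Mapping.keys_add[of "r j" s] by (auto simp: h_def)
    then obtain l where l: "k = t + l" "l \<in> Poly_Mapping.keys (r i)"
      using keys_mult[of "Poly_Mapping.single t (- c)" "r i"]
      by (auto simp: s_def split: if_splits)
    \<comment> \<open>Codes are multiplicative, so multiplying by \<open>t\<close> preserves the
      order: \<open>wt l \<le> wt (m i)\<close> gives
      \<open>wt (t + l) \<le> wt (t + m i)\<close>.\<close>
    then show ?thesis
      using D_ge[OF l(2)] by (simp add: wt(2) ij(2) m(2))
  qed
  \<comment> \<open>Minimality of \<open>r j\<close> gives the reverse inequality, so the leading
    monomial of \<open>h\<close> is the one just cancelled.\<close>
  then have "k = m j"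
    using le k(2) m(2) wt(1) by (metis antisym inj_eq)
  moreover have "Poly_Mapping.lookup h (m j) = 0"
    using m(1)[of i] unfolding h_def s_def ij(2) lookup_add lookup_single_mult
    by (simp add: c_def ij(2) in_keys_iff)
  ultimately show False
    using k(1) by (simp add: in_keys_iff)
qed

text \<open>A strictly descending chain of closed sets gives a strictly ascending chain of vanishing
  ideals: some defining polynomial of the smaller set fails to vanish on the larger one.\<close>

lemma wf_algebraic_set:
  "wf {(A, B :: 'n::finite proj_space set). algebraic_set A \<and> algebraic_set B \<and> A \<subset> B}"
  unfolding wf_iff_no_infinite_down_chain
proof
  assume "\<exists>C. \<forall>i. (C (Suc i), C i :: 'n proj_space set)
    \<in> {(A, B). algebraic_set A \<and> algebraic_set B \<and> A \<subset> B}"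
  then obtain C :: "nat \<Rightarrow> 'n proj_space set"
    where chain: "\<And>i. algebraic_set (C (Suc i)) \<and> algebraic_set (C i) \<and> C (Suc i) \<subset> C i"
    by auto
  then have C: "\<And>i. algebraic_set (C i)" "\<And>i. C (Suc i) \<subset> C i"
    by (simp_all only:)
  define I where "I n = {p. \<forall>P\<in>C n. \<forall>v\<in>hom_coords P. peval p v = 0}" for n
  have "I n \<subset> I (Suc n)" for n
  proof -
    obtain S where S: "C (Suc n) = zero_locus S"
      using C(1)[of "Suc n"] by (auto simp: algebraic_set_def)
    obtain P where "P \<in> C n" "P \<notin> C (Suc n)"
      using C(2)[of n] by auto
    then obtain p where "p \<in> S" "p \<notin> I n"
      unfolding S by (auto simp: zero_locus_def I_def)
    moreover from this have "p \<in> I (Suc n)"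
      by (auto simp: I_def S zero_locus_def)
    moreover have "I n \<subseteq> I (Suc n)"
      using C(2)[of n] by (auto simp: I_def)
    ultimately show ?thesis by blast
  qed
  then show False
    by (intro ideal_chain_not_strict[of I]) (auto simp: I_def peval_add peval_mult)
qed


section \<open>Values of rational maps\<close>

lemma peval_diff: "peval (p - q) v = peval p v - peval q v"
  using peval_add[of "p - q" q v] by (simp add: algebra_simps)

lemma homogeneous_add:
  assumes "homogeneous d p" "homogeneous d q"
  shows "homogeneous d (p + q)"
  using assms Poly_Mapping.keys_add[of p q] unfolding homogeneous_def by blast

lemma homogeneous_diff:
  assumes "homogeneous d p" "homogeneous d q"
  shows "homogeneous d (p - q)"
  using assms keys_diff[of p q] unfolding homogeneous_def by blast

definition coord_poly :: "'n \<Rightarrow> 'n::finite mpolynomial" where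
  "coord_poly i = Poly_Mapping.single (Poly_Mapping.single i 1) 1"

lemma peval_coord_poly [simp]: "peval (coord_poly i) v = v $ i"
proof -
  have "(\<Prod>j\<in>UNIV. v $ j ^ Poly_Mapping.lookup (Poly_Mapping.single i (1::nat)) j) =
      (\<Prod>j\<in>UNIV. if j = i then v $ j else 1)"
    by (intro prod.cong) (auto simp: lookup_single when_def)
  then show ?thesis
    by (simp add: coord_poly_def peval_single)
qed

lemma homogeneous_coord_poly: "homogeneous 1 (coord_poly i)"
  by (simp add: homogeneous_def coord_poly_def lookup_single when_def)

lemma line_of_hom_coords:
  assumes "v \<in> hom_coords P"
  shows "line_of P = range (\<lambda>c. c *s v)"
proof -
  obtain u where u: "line_of P = range (\<lambda>c. c *s u)"
    using line_of[of P] by auto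
  obtain a where a: "v = a *s u" "a \<noteq> 0"
    using assms u by (auto simp: hom_coords_def)
  have "c *s u = (c / a) *s v" "c *s v = (c * a) *s u" for c
    using a by (simp_all add: vector_smult_assoc)
  then show ?thesis
    unfolding u by (intro equalityI image_subsetI) (metis rangeI)+
qed

lemma proj_space_eqI:
  assumes "v \<in> hom_coords P" "v \<in> hom_coords Q"
  shows "P = Q"
  using line_of_hom_coords[OF assms(1)] line_of_hom_coords[OF assms(2)]
  by (metis line_of_inject)

lemma scale_hom_coords:
  assumes "v \<in> hom_coords P" "c \<noteq> 0"
  shows "c *s v \<in> hom_coords P"
proof -
  have "c *s v \<in> line_of P"
    using line_of_hom_coords[OF assms(1)] by blast
  then show ?thesis
    using assms by (simp add: hom_coords_def)
qed

lemma openin_zariski_on_subset: "openin (zariski_on V) W \<Longrightarrow> W \<subseteq> V"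
  using openin_subset[of "zariski_on V" W] by simp

lemma openin_zariski_on_trans:
  assumes "openin (zariski_on V) W" "openin (zariski_on \<X>) V"
  shows "openin (zariski_on \<X>) W"
  using assms openin_zariski_on_subset[OF assms(2)]
  by (metis inf.absorb2 openin_trans_full subtopology_subtopology)

section \<open>Agreement of regular functions and morphisms on a dense open set\<close>

lemma openin_nonvanishing:
  assumes "homogeneous d p"
  shows "openin zariski {Q. \<forall>v\<in>hom_coords Q. peval p v \<noteq> 0}"
proof -
  have "- {Q. \<forall>v\<in>hom_coords Q. peval p v \<noteq> 0} = zero_locus {p}"
    using peval_zero_hom_coords[OF assms] hom_coords_nonempty by (fastforce simp: zero_locus_def)
  then show ?thesis
    unfolding openin_zariski algebraic_set_def using assms by (intro exI[of _ "{p}"]) auto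
qed

text \<open>Take a nonzero coordinate \<open>i\<close> of \<open>a\<close> and \<open>j\<close> of
  \<open>b\<close>. If neither coordinate form works, then \<open>b $ i = 0\<close> and
  \<open>a $ j = 0\<close>, so their sum does.\<close>

lemma linear_form_nonvanishing:
  fixes a b :: "qbar ^ 'n::finite"
  assumes "a \<noteq> 0" "b \<noteq> 0"
  obtains l where "homogeneous 1 l" "peval l a \<noteq> 0" "peval l b \<noteq> 0"
proof -
  obtain i j where ij: "a $ i \<noteq> 0" "b $ j \<noteq> 0"
    using assms by (auto simp: vec_eq_iff)
  have "\<exists>l\<in>{coord_poly i, coord_poly j, coord_poly i + coord_poly j}. peval l a \<noteq> 0 \<and> peval l b \<noteq> 0"
    using ij by (auto simp: peval_add)
  moreover have "\<forall>l\<in>{coord_poly i, coord_poly j, coord_poly i + coord_poly j}. homogeneous 1 l"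
    using homogeneous_coord_poly homogeneous_add by blast
  ultimately show ?thesis
    using that by blast
qed

text \<open>Equal degrees make the scaling factors cancel, so the vector picked by
  \<open>SOME\<close> does not affect the value.\<close>

lemma regular_function_quotient:
  assumes "homogeneous d p" "homogeneous d q"
    and "\<And>Q v. Q \<in> V \<Longrightarrow> v \<in> hom_coords Q \<Longrightarrow> peval q v \<noteq> 0"
  shows "regular_function V
    (\<lambda>Q. peval p (SOME v. v \<in> hom_coords Q) / peval q (SOME v. v \<in> hom_coords Q))"
  unfolding regular_function_def
proof (intro ballI)
  fix P assume "P \<in> V"
  have "peval p (SOME v. v \<in> hom_coords Q) / peval q (SOME v. v \<in> hom_coords Q) =
      peval p v / peval q v" if v: "v \<in> hom_coords Q" for Q v
  proof -
    have "(SOME v. v \<in> hom_coords Q) \<in> hom_coords Q"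
      by (rule someI_ex) (rule hom_coords_nonempty)
    then obtain c where "c \<noteq> 0" "(SOME v. v \<in> hom_coords Q) = c *s v"
      using hom_coordsE[OF v] by blast
    then show ?thesis
      by (simp add: peval_scale[OF assms(1)] peval_scale[OF assms(2)])
  qed
  moreover have "openin (zariski_on V) V"
    using openin_topspace[of "zariski_on V"] by simp
  ultimately show "\<exists>W p' q' d. openin (zariski_on V) W \<and> P \<in> W \<and> homogeneous d p' \<and>
      homogeneous d q' \<and> (\<forall>Q\<in>W. \<forall>v\<in>hom_coords Q. peval q' v \<noteq> 0 \<and>
        peval p (SOME v. v \<in> hom_coords Q) / peval q (SOME v. v \<in> hom_coords Q) =
        peval p' v / peval q' v)"
    using assms \<open>P \<in> V\<close> by (intro exI[of _ V] exI[of _ p] exI[of _ q] exI[of _ d]) auto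
qed

text \<open>Near \<open>P\<close> the functions differ exactly where the cross difference
  \<open>g\<close> of their fractions is nonzero. That locus is open, so if it contained
  \<open>P\<close> it would meet \<open>W\<close>.\<close>

lemma regular_functions_eq_if_dense:
  assumes V: "openin (zariski_on \<X>) V\<^sub>1" "openin (zariski_on \<X>) V\<^sub>2"
    and reg: "regular_function V\<^sub>1 f\<^sub>1" "regular_function V\<^sub>2 f\<^sub>2"
    and W: "dense_open \<X> W" "\<And>Q. Q \<in> W \<inter> V\<^sub>1 \<inter> V\<^sub>2 \<Longrightarrow> f\<^sub>1 Q = f\<^sub>2 Q"
    and P: "P \<in> V\<^sub>1" "P \<in> V\<^sub>2"
  shows "f\<^sub>1 P = f\<^sub>2 P"
proof (rule ccontr)
  assume neq: "f\<^sub>1 P \<noteq> f\<^sub>2 P"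
  obtain W1 p1 q1 d1 where 1: "openin (zariski_on V\<^sub>1) W1" "P \<in> W1" "homogeneous d1 p1"
      "homogeneous d1 q1"
      "\<And>Q v. Q \<in> W1 \<Longrightarrow> v \<in> hom_coords Q \<Longrightarrow> peval q1 v \<noteq> 0 \<and> f\<^sub>1 Q = peval p1 v / peval q1 v"
    using reg(1) P(1) unfolding regular_function_def by metis
  obtain W2 p2 q2 d2 where 2: "openin (zariski_on V\<^sub>2) W2" "P \<in> W2" "homogeneous d2 p2"
      "homogeneous d2 q2"
      "\<And>Q v. Q \<in> W2 \<Longrightarrow> v \<in> hom_coords Q \<Longrightarrow> peval q2 v \<noteq> 0 \<and> f\<^sub>2 Q = peval p2 v / peval q2 v"
    using reg(2) P(2) unfolding regular_function_def by metis
  define g where "g = p1 * q2 - q1 * p2"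
  have g: "homogeneous (d1 + d2) g"
    unfolding g_def using 1(3,4) 2(3,4) by (intro homogeneous_diff homogeneous_mult)
  have g_iff: "peval g v = 0 \<longleftrightarrow> f\<^sub>1 Q = f\<^sub>2 Q" if "Q \<in> W1" "Q \<in> W2" "v \<in> hom_coords Q" for Q v
    using 1(5)[OF that(1,3)] 2(5)[OF that(2,3)]
    by (simp add: g_def peval_diff peval_mult frac_eq_eq mult.commute)
  define N where "N = W1 \<inter> W2 \<inter> {Q. \<forall>v\<in>hom_coords Q. peval g v \<noteq> 0}"
  have sub: "V\<^sub>1 \<subseteq> \<X>" "V\<^sub>2 \<subseteq> \<X>" "W1 \<subseteq> V\<^sub>1" "W2 \<subseteq> V\<^sub>2"
    using V 1(1) 2(1) by (simp_all add: openin_zariski_on_subset)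
  have W12: "openin (zariski_on \<X>) W1" "openin (zariski_on \<X>) W2"
    using 1(1) 2(1) V by (blast intro: openin_zariski_on_trans)+
  have "openin (zariski_on \<X>) (W1 \<inter> W2 \<inter> (\<X> \<inter> {Q. \<forall>v\<in>hom_coords Q. peval g v \<noteq> 0}))"
    using W12 openin_subtopology_Int2[OF openin_nonvanishing[OF g]]
    by (intro openin_Int[of _ "_ \<inter> _"] openin_Int[of _ W1])
  moreover have "W1 \<inter> W2 \<inter> (\<X> \<inter> {Q. \<forall>v\<in>hom_coords Q. peval g v \<noteq> 0}) = N"
    using sub by (auto simp: N_def)
  ultimately have "openin (zariski_on \<X>) N"
    by simp
  moreover have "P \<in> N"
    using 1(2) 2(2) g_iff neq by (auto simp: N_def)
  moreover have "P \<in> zariski_on \<X> closure_of W"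
    using W(1) P(1) sub by (auto simp: dense_open_def)
  ultimately obtain Q where Q: "Q \<in> W" "Q \<in> N"
    unfolding in_closure_of by blast
  then have "f\<^sub>1 Q = f\<^sub>2 Q"
    using sub by (intro W(2)) (auto simp: N_def)
  then show False
    using Q(2) g_iff hom_coords_nonempty[of Q] by (auto simp: N_def)
qed

text \<open>Two distinct values lie in the complement of a common hyperplane \<open>l = 0\<close>, an affine chart on
  which the regular functions \<open>x\<^sub>i / l\<close> separate points.\<close>

lemma morphisms_eq_if_dense:
  fixes f g :: "'n::finite proj_space \<Rightarrow> 'm::finite proj_space"
  assumes U: "openin (zariski_on \<X>) U" "openin (zariski_on \<X>) V"
    and mor: "morphism U \<Y> f" "morphism V \<Y> g"
    and W: "dense_open \<X> W" "\<And>Q. Q \<in> W \<Longrightarrow> f Q = g Q"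
    and x: "x \<in> U" "x \<in> V"
  shows "f x = g x"
proof -
  have cont: "continuous_map (zariski_on U) (zariski_on \<Y>) f"
      "continuous_map (zariski_on V) (zariski_on \<Y>) g"
    using mor by (auto simp: morphism_def)
  obtain a b where ab: "a \<in> hom_coords (f x)" "b \<in> hom_coords (g x)"
    using hom_coords_nonempty by metis
  then have "a \<noteq> 0" "b \<noteq> 0"
    by (auto simp: hom_coords_def)
  then obtain l where l: "homogeneous 1 l" "peval l a \<noteq> 0" "peval l b \<noteq> 0"
    by (rule linear_form_nonvanishing)
  define H where "H = {Q. \<forall>v\<in>hom_coords Q. peval l v \<noteq> 0}"
  define N where "N = \<Y> \<inter> H"
  have N: "openin (zariski_on \<Y>) N"
    unfolding N_def H_def using openin_nonvanishing[OF l(1)] by (rule openin_subtopology_Int2)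
  have H: "f x \<in> H" "g x \<in> H"
    unfolding H_def using l ab peval_zero_hom_coords[OF l(1)] by blast+
  have xN: "f x \<in> N" "g x \<in> N"
    unfolding N_def using H x cont by (auto simp: continuous_map_def Pi_iff)
  define h where "h i Q = peval (coord_poly i) (SOME v. v \<in> hom_coords Q) / peval l (SOME v. v \<in> hom_coords Q)"
    for i and Q :: "'m proj_space"
  have pre: "openin (zariski_on \<X>) {x \<in> U. f x \<in> N}" "openin (zariski_on \<X>) {x \<in> V. g x \<in> N}"
  proof -
    have "openin (zariski_on U) {x \<in> U. f x \<in> N}" "openin (zariski_on V) {x \<in> V. g x \<in> N}"
      using cont N openin_continuous_map_preimage by fastforce+
    then show "openin (zariski_on \<X>) {x \<in> U. f x \<in> N}" "openin (zariski_on \<X>) {x \<in> V. g x \<in> N}"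
      using U by (blast intro: openin_zariski_on_trans)+
  qed
  have eq: "h i (f x) = h i (g x)" for i
  proof -
    \<comment> \<open>Morphisms pull regular functions back to regular functions, so the agreement
      on \<open>W\<close> extends to \<open>x\<close>.\<close>
    have "regular_function N (h i)"
      unfolding h_def using homogeneous_coord_poly l(1)
      by (rule regular_function_quotient) (auto simp: N_def H_def)
    then have "regular_function {x \<in> U. f x \<in> N} (h i \<circ> f)"
        "regular_function {x \<in> V. g x \<in> N} (h i \<circ> g)"
      using mor N unfolding morphism_def by blast+
    then have "(h i \<circ> f) x = (h i \<circ> g) x"
      by (rule regular_functions_eq_if_dense[OF pre _ _ W(1)]) (use W(2) x xN in auto)
    then show ?thesis by simp
  qed
  define a' b' where "a' = (SOME v. v \<in> hom_coords (f x))" and "b' = (SOME v. v \<in> hom_coords (g x))"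
  have a'b': "a' \<in> hom_coords (f x)" "b' \<in> hom_coords (g x)"
    unfolding a'_def b'_def by (rule someI_ex, rule hom_coords_nonempty)+
  then have nz: "peval l a' \<noteq> 0" "peval l b' \<noteq> 0"
    using H by (auto simp: H_def)
  \<comment> \<open>Equality of all ratios \<open>x_i / l\<close> makes the two coordinate vectors
    proportional.\<close>
  have "a' $ i = (peval l a' / peval l b') * b' $ i" for i
    using eq[of i] nz by (simp add: h_def a'_def[symmetric] b'_def[symmetric] field_simps)
  then have "a' = (peval l a' / peval l b') *s b'"
    by (simp add: vec_eq_iff)
  then have "a' \<in> hom_coords (g x)"
    using scale_hom_coords[OF a'b'(2)] nz by (metis divide_eq_0_iff)
  then show ?thesis
    using a'b'(1) proj_space_eqI by blast
qed

section \<open>Evaluation of rational maps, preimages and orbits\<close>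

lemma rational_mapsD:
  assumes "\<Phi> \<in> rational_maps \<X> \<Y>" "(U, f) \<in> \<Phi>"
  shows "openin (zariski_on \<X>) U" "morphism U \<Y> f"
proof -
  have "(U, f) \<in> partial_morphisms \<X> \<Y>"
    using assms in_quotient_imp_subset[OF equiv_rational_equiv] unfolding rational_maps_def by blast
  then show "openin (zariski_on \<X>) U" "morphism U \<Y> f"
    by (auto simp: partial_morphisms_def dense_open_def)
qed

text \<open>Two representatives agree on a dense open set, hence wherever both are defined; this
  supplies the uniqueness behind \<open>THE\<close>.\<close>

lemma rat_apply_eq:
  assumes \<Phi>: "\<Phi> \<in> rational_maps \<X> \<Y>" and f: "(U, f) \<in> \<Phi>" "x \<in> U"
  shows "rat_apply \<Phi> x = f x"
proof -
  have unique: "g x = f x" if g: "(V, g) \<in> \<Phi>" "x \<in> V" for V g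
  proof -
    have "((U, f), (V, g)) \<in> rational_equiv \<X> \<Y>"
      using in_quotient_imp_in_rel[OF equiv_rational_equiv] \<Phi> f(1) g(1)
      unfolding rational_maps_def by blast
    then obtain W where W: "dense_open \<X> W" "\<forall>x\<in>W. f x = g x"
      unfolding rational_equiv_def by blast
    have "f x = g x"
      by (rule morphisms_eq_if_dense[OF rational_mapsD(1)[OF \<Phi> f(1)] rational_mapsD(1)[OF \<Phi> g(1)]
        rational_mapsD(2)[OF \<Phi> f(1)] rational_mapsD(2)[OF \<Phi> g(1)] W(1)])
        (use W(2) f(2) g(2) in auto)
    then show ?thesis by simp
  qed
  show ?thesis
    unfolding rat_apply_def
  proof (rule the_equality)
    show "\<exists>(U, g)\<in>\<Phi>. x \<in> U \<and> f x = g x"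
      using f by auto
    show "y = f x" if "\<exists>(U, g)\<in>\<Phi>. x \<in> U \<and> y = g x" for y
      using that unique by blast
  qed
qed

lemma rat_apply_in:
  assumes "\<Phi> \<in> rational_maps \<X> \<Y>" "x \<in> rat_domain \<Phi>"
  shows "rat_apply \<Phi> x \<in> \<Y>"
proof -
  obtain U f where f: "(U, f) \<in> \<Phi>" "x \<in> U"
    using assms(2) by (auto simp: rat_domain_def)
  then have "f x \<in> \<Y>"
    using rational_mapsD(2)[OF assms(1) f(1)] by (auto simp: morphism_def continuous_map_def Pi_iff)
  then show ?thesis
    using rat_apply_eq[OF assms(1) f] by simp
qed

text \<open>The points sent outside \<open>C\<close> form a union of open preimages under the
  representatives. \<open>B\<close> is the complement of an ambient open set with this trace on
  \<open>\<X>\<close>.\<close>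

lemma algebraic_set_rat_preimage:
  assumes \<Phi>: "\<Phi> \<in> rational_maps \<X> \<Y>" and "algebraic_set C"
  shows "\<exists>B. algebraic_set B \<and> (\<forall>x\<in>rat_domain \<Phi>. x \<in> B \<longleftrightarrow> rat_apply \<Phi> x \<in> C)"
proof -
  define D where "D = (\<Union>(U, f)\<in>\<Phi>. {x \<in> U. f x \<in> \<Y> - C})"
  have C: "openin (zariski_on \<Y>) (\<Y> - C)"
    using assms(2) openin_subtopology_Int2[of zariski "- C" \<Y>] by (simp add: openin_zariski Diff_eq)
  have "openin (zariski_on \<X>) {x \<in> U. f x \<in> \<Y> - C}" if "(U, f) \<in> \<Phi>" for U f
  proof -
    have "continuous_map (zariski_on U) (zariski_on \<Y>) f"
      using rational_mapsD(2)[OF \<Phi> that] by (simp add: morphism_def)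
    then have "openin (zariski_on U) {x \<in> U. f x \<in> \<Y> - C}"
      using openin_continuous_map_preimage[OF _ C] by fastforce
    then show ?thesis
      using rational_mapsD(1)[OF \<Phi> that] by (rule openin_zariski_on_trans)
  qed
  then have "openin (zariski_on \<X>) D"
    unfolding D_def by (intro openin_Union) auto
  then obtain T where T: "algebraic_set (- T)" "D = T \<inter> \<X>"
    by (auto simp: openin_subtopology openin_zariski)
  have "x \<in> - T \<longleftrightarrow> rat_apply \<Phi> x \<in> C" if x: "x \<in> rat_domain \<Phi>" for x
  proof -
    have "x \<in> \<X>"
      using x rational_mapsD(1)[OF \<Phi>] by (fastforce simp: rat_domain_def dest: openin_subset)
    then have "x \<in> T \<longleftrightarrow> x \<in> D"
      by (simp add: T(2))
    also have "\<dots> \<longleftrightarrow> rat_apply \<Phi> x \<notin> C"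
      using x rat_apply_eq[OF \<Phi>] rat_apply_in[OF \<Phi> x] by (fastforce simp: D_def rat_domain_def)
    finally show ?thesis by simp
  qed
  with T(1) show ?thesis by blast
qed

text \<open>The indeterminacy locus lies inside \<open>\<X>\<close>, so avoiding it yields
  membership in the domain only for points known to be in \<open>\<X>\<close>. Induction carries
  both facts along.\<close>

lemma rat_iterate_in:
  assumes "\<Phi> \<in> rational_maps \<X> \<X>" "x \<in> well_defined_orbit_points \<X> \<Phi>"
  shows "rat_iterate \<Phi> n x \<in> \<X>" "rat_iterate \<Phi> n x \<in> rat_domain \<Phi>"
proof -
  have dom: "rat_iterate \<Phi> n x \<in> rat_domain \<Phi>" if "rat_iterate \<Phi> n x \<in> \<X>" for n
    using that assms(2) by (auto simp: well_defined_orbit_points_def indeterminacy_locus_def)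
  show "rat_iterate \<Phi> n x \<in> \<X>"
  proof (induction n)
    case 0
    then show ?case
      using assms(2) by (simp add: rat_iterate_def well_defined_orbit_points_def)
  next
    case (Suc n)
    then show ?case
      using rat_apply_in[OF assms(1) dom[OF Suc]] by (simp add: rat_iterate_def)
  qed
  then show "rat_iterate \<Phi> n x \<in> rat_domain \<Phi>"
    by (rule dom)
qed


section \<open>Return times of rational maps\<close>

theorem theorem1p7:
  fixes \<X> \<Y> :: "'n::finite proj_space set"
    and \<Phi> :: "('n, 'n) partial_map set"
    and x :: "'n proj_space"
  assumes "quasi_projective_variety \<X>"
    and "\<Phi> \<in> rational_maps \<X> \<X>"
    and "subvariety \<Y> \<X>"
    and "x \<in> well_defined_orbit_points \<X> \<Phi>"
  shows "\<exists>\<A> Z. finite \<A> \<and> (\<forall>A\<in>\<A>. arithmetic_progression A) \<and> upper_density Z = 0 \<and>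
           {n. rat_iterate \<Phi> n x \<in> \<Y>} = \<Union>\<A> \<union> Z"
proof -
  \<comment> \<open>\<open>\<Y>\<close> is closed only relative to \<open>\<X>\<close>, while the
    chain condition concerns closed sets of projective space. The orbit stays in
    \<open>\<X>\<close>, so \<open>C\<close> and \<open>\<Y>\<close> have the same return
    times.\<close>
  obtain C where C: "algebraic_set C" "\<Y> = C \<inter> \<X>"
    using assms(3) by (auto simp: subvariety_def closedin_subtopology closedin_zariski)
  note orbit = rat_iterate_in[OF assms(2,4)]
  have "progressions_up_to_density_zero {n. rat_iterate \<Phi> n x \<in> C}"
  proof (rule return_times_noetherian[OF wf_algebraic_set])
    show "algebraic_set (A \<inter> B)" if "algebraic_set A" "algebraic_set B"
      for A B :: "'n proj_space set"
      using algebraic_set_Inter[of "{A, B}"] that by auto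
    show "\<exists>B. algebraic_set B \<and> (\<forall>n. rat_iterate \<Phi> n x \<in> B \<longleftrightarrow> rat_iterate \<Phi> (Suc n) x \<in> A)"
      if "algebraic_set A" for A
      using algebraic_set_rat_preimage[OF assms(2) that] orbit(2)
      by (auto simp: rat_iterate_def)
  qed (rule C)
  moreover have "{n. rat_iterate \<Phi> n x \<in> C} = {n. rat_iterate \<Phi> n x \<in> \<Y>}"
    using orbit(1) by (auto simp: C(2))
  ultimately show ?thesis
    unfolding progressions_up_to_density_zero_def
    using density_zero_imp_upper_density by metis
qed

end
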